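(* If $s=2^x$ with $x\in\{0,1,2,\dots\}$, then $\mathrm{ord}_2\left(c_0\left[E_{\infty,4}^{-s}\right]\right)=3$.
   Context: Let $q=e^{2\pi i z}$ with $\mathrm{Im}\, z>0$. $E_{\infty,4}$ is the weight $4$ entire modular form for $\Gamma_0(2)$ (matrices in $SL(2,\mathbf Z)$ with lower left entry even) with Fourier expansion $$E_{\infty,4}=\sum_{n=1}^{\infty}\sigma_{2,3}^{*}(n)\,q^n,\qquad \sigma_{2,3}^{*}(n)=\sum_{0<d\mid n,\ 2\nmid (n/d)} d^3 .$$ For a meromorphic modular form $f$ with Fourier expansion at infinity $f=\sum_n c_n q^n$ (finitely many negative exponents), $c_n[f]$ denotes the coefficient $c_n$ of $q^n$. $\mathrm{ord}_2$ denotes the $2$-adic valuation on rational numbers (with $\mathrm{ord}_2(0)=\infty$). *)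

theory Defs
  imports
    "HOL-Analysis.Analysis"
    "HOL-Library.Extended_Real"
    "HOL-Computational_Algebra.Formal_Laurent_Series"
begin

definition sigma_star_2_3 :: "nat \<Rightarrow> nat" where
  "sigma_star_2_3 n = (\<Sum>d | 0 < d \<and> d dvd n \<and> \<not> 2 dvd (n div d). d ^ 3)"

text \<open>Functions on the upper half-plane are total functions on the complex numbers whose values
  outside of \<open>Im z > 0\<close> are irrelevant.\<close>

definition E_inf_4 :: "complex \<Rightarrow> complex" where
  "E_inf_4 z = (\<Sum>\<^sub>\<infinity>n\<in>{1..}. of_nat (sigma_star_2_3 n) * exp (2 * of_real pi * \<i> * z) ^ n)"

text \<open>A meromorphic modular form may have poles in the upper half-plane, so the expansion
  \<open>f z = (\<Sum>n. c n * q ^ n)\<close>, with \<open>q = exp (2 * pi * \<i> * z)\<close>, is only required for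
  sufficiently large imaginary part. A formal Laurent series has only finitely many
  nonzero coefficients of negative index.\<close>

definition has_fourier_expansion :: "(complex \<Rightarrow> complex) \<Rightarrow> complex fls \<Rightarrow> bool" where
  "has_fourier_expansion f F \<longleftrightarrow>
     (\<exists>y\<ge>0. \<forall>z. Im z > y \<longrightarrow>
        ((\<lambda>n::int. fls_nth F n * exp (2 * of_real pi * \<i> * z) powi n) has_sum f z) UNIV)"

definition fourier_coeff :: "int \<Rightarrow> (complex \<Rightarrow> complex) \<Rightarrow> complex" where
  "fourier_coeff n f = fls_nth (THE F. has_fourier_expansion f F) n"

definition ord2 :: "rat \<Rightarrow> ereal" where
  "ord2 r = (if r = 0 then \<infinity>
     else ereal (real (multiplicity 2 (fst (quotient_of r)))
               - real (multiplicity 2 (snd (quotient_of r)))))"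

end

theory Submission
  imports Defs "HOL-Number_Theory.Cong" "HOL-Complex_Analysis.Laurent_Convergence"
begin

text \<open>
Write \<open>E = \<Sum> \<sigma>\<^sup>*(n) q^n = q F\<close>, where \<open>F\<close> is an integral power series with constant term 1, and let
\<open>\<theta> = q d/dq\<close>. The constant term of \<open>E^(-s)\<close> is the coefficient of \<open>q^s\<close> in \<open>F^(-s)\<close>, an integer, and the
claim is that it is congruent to 8 modulo 16.

The logarithmic derivative \<open>\<theta>E / E\<close> is the quasimodular form
\<open>1 + 8 \<Sum> \<sigma>(n) q^n - 32 \<Sum> \<sigma>(n) q^(2n)\<close>. Only its class modulo 16 matters, where \<open>\<sigma>(n)\<close> may be replaced
by the number of odd divisors of \<open>n\<close>: with \<open>R = \<Sum> num_odd_divisors n q^n\<close>,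
it says \<open>\<theta>F \<equiv> 8 R F\<close> modulo 16. From this, \<open>inverse_power_coeff_mod_16\<close> deduces by comparing coefficients
in \<open>\<theta>(F^(-s))\<close> that for \<open>s = 2^x\<close> the coefficient of \<open>q^s\<close> in \<open>F^(-s)\<close> is congruent modulo 16 to 8 times
the coefficient of \<open>q^s\<close> in \<open>R\<close>. The latter is 1, as 1 is the only odd divisor of a power of two.

The congruence itself, \<open>sigma_star_convolution_mod_16\<close>, has an elementary proof. Modulo 2
the coefficient of \<open>q^n\<close> in \<open>R E\<close> is the number of solutions of \<open>a b + c d = n\<close> with \<open>a, c, d\<close> odd.
Liouville's substitution \<open>(a, b, c, d) \<mapsto> (a - c, b, c, b + d)\<close> shows that for odd \<open>n\<close> this number has the same
parity as \<open>\<Sum> (m + 1) div 4\<close> over the divisors \<open>m\<close> of \<open>n\<close>. Finally \<open>8 ((m + 1) div 4) \<equiv> m^2 - 1\<close>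
modulo 16 for odd \<open>m\<close>, which compares this sum with \<open>(n - 1) \<sigma>\<^sup>*(n)\<close>.

The analytic part identifies Fourier expansions with Laurent expansions in \<open>q\<close> at 0, which are unique
and compatible with integer powers.
\<close>

section \<open>Solutions of \<open>a b + c d = n\<close>\<close>

text \<open>The product of the series \<open>\<Sum> d(k) q^k\<close> and \<open>\<Sum> d'(k) q^k\<close> of two divisor functions has as coefficients
numbers of solutions of \<open>a b + c d = n\<close> with side conditions on \<open>a, b, c, d\<close>. All the arithmetic below
is a comparison of such numbers by bijections.\<close>

definition decomps :: "nat \<Rightarrow> (nat \<times> nat \<times> nat \<times> nat) set" where
  "decomps n = {(a, b, c, d). 0 < a \<and> 0 < b \<and> 0 < c \<and> 0 < d \<and> a * b + c * d = n}"

abbreviation num_decomps :: "nat \<Rightarrow> (nat \<Rightarrow> nat \<Rightarrow> nat \<Rightarrow> nat \<Rightarrow> bool) \<Rightarrow> nat" where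
  "num_decomps n P \<equiv> card {(a, b, c, d) \<in> decomps n. P a b c d}"

lemma finite_decomps: "finite (decomps n)"
proof (rule finite_subset)
  show "decomps n \<subseteq> {..n} \<times> {..n} \<times> {..n} \<times> {..n}"
  proof
    fix t assume "t \<in> decomps n"
    then obtain a b c d where t: "t = (a, b, c, d)"
      and pos: "0 < a" "0 < b" "0 < c" "0 < d" and n: "a * b + c * d = n"
      by (auto simp: decomps_def)
    have "a \<le> a * b" "b \<le> a * b" "c \<le> c * d" "d \<le> c * d" using pos by auto
    then have "a \<le> n" "b \<le> n" "c \<le> n" "d \<le> n" using n by linarith+
    then show "t \<in> {..n} \<times> {..n} \<times> {..n} \<times> {..n}" using t by auto
  qed
qed auto

lemma finite_decomps_filter [simp, intro]: "finite {(a, b, c, d) \<in> decomps n. P a b c d}"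
  by (rule finite_subset[OF _ finite_decomps[of n]]) auto

lemma num_decomps_cong:
  assumes "\<And>a b c d. (a, b, c, d) \<in> decomps n \<Longrightarrow> P a b c d \<longleftrightarrow> Q a b c d"
  shows "num_decomps n P = num_decomps n Q"
  using assms by (intro arg_cong[where f = card]) auto

lemma num_decomps_split:
  "num_decomps n P = num_decomps n (\<lambda>a b c d. P a b c d \<and> R a b c d)
                   + num_decomps n (\<lambda>a b c d. P a b c d \<and> \<not> R a b c d)"
  by (subst card_Un_disjoint[symmetric]) (auto intro!: arg_cong[where f = card])

lemma num_decomps_swap: "num_decomps n P = num_decomps n (\<lambda>a b c d. P c d a b)"
  by (rule bij_betw_same_card[OF bij_betw_byWitness[where f = "\<lambda>(a, b, c, d). (c, d, a, b)"
        and f' = "\<lambda>(a, b, c, d). (c, d, a, b)"]])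
     (auto simp: decomps_def)

text \<open>Liouville's substitution: \<open>(a - c) b + c (b + d) = a b + c d\<close>. It trades an inequality between the
first factors \<open>a\<close>, \<open>c\<close> for one between the second factors \<open>b\<close>, \<open>d\<close>.\<close>

lemma num_decomps_shear:
  "num_decomps n (\<lambda>a b c d. c < a \<and> P (a - c) b c (b + d)) = num_decomps n (\<lambda>a b c d. b < d \<and> P a b c d)"
  (is "card ?L = card ?R")
proof (rule bij_betw_same_card[OF bij_betw_byWitness[where f = "\<lambda>(a, b, c, d). (a - c, b, c, b + d)"
        and f' = "\<lambda>(a, b, c, d). (a + c, b, c, d - b)"]])
  show "\<forall>t\<in>?L. (\<lambda>(a, b, c, d). (a + c, b, c, d - b)) ((\<lambda>(a, b, c, d). (a - c, b, c, b + d)) t) = t"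
    by auto
  show "\<forall>t\<in>?R. (\<lambda>(a, b, c, d). (a - c, b, c, b + d)) ((\<lambda>(a, b, c, d). (a + c, b, c, d - b)) t) = t"
    by auto
  have "(a - c) * b + c * (b + d) = a * b + c * d" if less: "c < a" for a b c d :: nat
  proof -
    obtain k where "a = c + k" using less_imp_add_positive[OF less] by blast
    then show ?thesis by (simp add: algebra_simps)
  qed
  then show "(\<lambda>(a, b, c, d). (a - c, b, c, b + d)) ` ?L \<subseteq> ?R"
    by (auto simp: decomps_def)
  have "(a + c) * b + c * (d - b) = a * b + c * d" if "b < d" for a b c d :: nat
  proof -
    have "c * b \<le> c * d" using that by simp
    then show ?thesis by (simp add: diff_mult_distrib2 algebra_simps)
  qed
  then show "(\<lambda>(a, b, c, d). (a + c, b, c, d - b)) ` ?R \<subseteq> ?L"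
    by (auto simp: decomps_def)
qed

text \<open>Exchanging the two products pairs off the solutions that an antisymmetric relation \<open>R\<close> can
distinguish from their partners.\<close>

lemma num_decomps_antisym:
  assumes sym: "\<And>a b c d. P a b c d \<longleftrightarrow> P c d a b"
    and antisym: "\<And>a b c d. R a b c d \<Longrightarrow> \<not> R c d a b"
  shows "even (num_decomps n P) \<longleftrightarrow>
    even (num_decomps n (\<lambda>a b c d. P a b c d \<and> \<not> R a b c d \<and> \<not> R c d a b))"
proof -
  have "num_decomps n P = num_decomps n (\<lambda>a b c d. P a b c d \<and> R a b c d)
      + num_decomps n (\<lambda>a b c d. P a b c d \<and> \<not> R a b c d)"
    by (rule num_decomps_split)
  also have "num_decomps n (\<lambda>a b c d. P a b c d \<and> \<not> R a b c d)
      = num_decomps n (\<lambda>a b c d. (P a b c d \<and> \<not> R a b c d) \<and> R c d a b)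
      + num_decomps n (\<lambda>a b c d. (P a b c d \<and> \<not> R a b c d) \<and> \<not> R c d a b)"
    by (rule num_decomps_split)
  also have "num_decomps n (\<lambda>a b c d. (P a b c d \<and> \<not> R a b c d) \<and> R c d a b)
      = num_decomps n (\<lambda>a b c d. P a b c d \<and> R c d a b)"
    by (rule num_decomps_cong) (use antisym in blast)
  also have "\<dots> = num_decomps n (\<lambda>a b c d. P a b c d \<and> R a b c d)"
    by (subst num_decomps_swap) (simp add: sym)
  finally have "num_decomps n P = 2 * num_decomps n (\<lambda>a b c d. P a b c d \<and> R a b c d)
      + num_decomps n (\<lambda>a b c d. P a b c d \<and> \<not> R a b c d \<and> \<not> R c d a b)"
    by simp
  then show ?thesis by presburger
qed

text \<open>For odd \<open>a > c\<close> with \<open>a + c \<equiv> 0\<close> modulo 4 the first factor \<open>a - c\<close> after the substitution is \<open>\<equiv> 2\<close>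
modulo 4. In the opposite direction, \<open>a + c \<equiv> 2\<close> modulo 4 gives a first factor \<open>\<equiv> 2\<close> as well, so that both
halves of the solutions with odd \<open>a, c, d\<close> are compared with this one class.\<close>

abbreviation sheared where "sheared a c d \<equiv> a mod 4 = (2::nat) \<and> odd (c::nat) \<and> odd (d::nat)"

text \<open>For odd \<open>n\<close>, write \<open>Q\<close> for the solutions with \<open>a, c, d\<close> odd (so that \<open>b\<close> is even) and \<open>V\<close> for those with
\<open>sheared a c d\<close>. Up to exchanging \<open>a b\<close> and \<open>c d\<close>,
Liouville's substitution turns the part of \<open>Q\<close> with \<open>4 | a + c\<close> into
the part \<open>b < d\<close> of \<open>V\<close>, and (read backwards) the rest of \<open>Q\<close> into the part \<open>c < a\<close> of \<open>V\<close>. It also matches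
the parts \<open>a < c\<close> and \<open>d < b\<close> of \<open>V\<close>. Since \<open>a \<noteq> c\<close> throughout \<open>V\<close>, this gives
\<open>|Q| + |V(b = d)| + 2 |V(d < b)| = 2 |V|\<close>. The point is that the diagonal \<open>b = d\<close> is an elementary
divisor sum, whereas \<open>Q\<close> is a convolution.\<close>

lemma odd_decomps_parity:
  assumes "odd n"
  shows "even (num_decomps n (\<lambda>a b c d. odd a \<and> odd c \<and> odd d))
     \<longleftrightarrow> even (num_decomps n (\<lambda>a b c d. sheared a c d \<and> b = d))"
proof -
  let ?N = "num_decomps n"
  have odd_n: "odd a \<and> odd c \<and> odd d \<Longrightarrow> even b" if "(a, b, c, d) \<in> decomps n" for a b c d
    using that assms by (auto simp: decomps_def)
  have even_mod: "even a" if "a mod 4 = 2" for a :: nat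
    using that by presburger
  \<comment> \<open>The condition \<open>4 | a + c\<close> says \<open>a - c \<equiv> 2\<close> modulo 4, because \<open>2 c \<equiv> 2\<close>.\<close>
  have mod4: "odd a \<and> odd c \<and> (a + c) mod 4 = 0 \<longleftrightarrow> (a - c) mod 4 = 2 \<and> odd c" if "c < a" for a c :: nat
  proof (cases "odd c")
    case True
    then obtain m where c: "c = 2 * m + 1" by (elim oddE)
    define k where "k = a - c"
    have a: "a = c + k" using that by (simp add: k_def)
    have "odd (2 * m + 1 + k) \<and> (4 * m + 2 + k) mod 4 = 0 \<longleftrightarrow> k mod 4 = 2"
      by presburger
    moreover have "a + c = 4 * m + 2 + k" using a c by simp
    ultimately show ?thesis using True a c by simp
  qed auto
  have parity: "even q \<longleftrightarrow> even v" if "q + v + 2 * t = 2 * w" for q v t w :: nat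
    using that by presburger
  have Q: "?N (\<lambda>a b c d. odd a \<and> odd c \<and> odd d) =
      ?N (\<lambda>a b c d. (odd a \<and> odd c \<and> odd d) \<and> (a + c) mod 4 = 0) +
      ?N (\<lambda>a b c d. (odd a \<and> odd c \<and> odd d) \<and> (a + c) mod 4 \<noteq> 0)"
    by (rule num_decomps_split)
  have Q1: "?N (\<lambda>a b c d. (odd a \<and> odd c \<and> odd d) \<and> (a + c) mod 4 = 0) = ?N (\<lambda>a b c d. sheared a c d \<and> b < d)"
  proof -
    have "?N (\<lambda>a b c d. (odd a \<and> odd c \<and> odd d) \<and> (a + c) mod 4 = 0)
        = ?N (\<lambda>a b c d. ((odd a \<and> odd c \<and> odd d) \<and> (a + c) mod 4 = 0) \<and> c < a)
        + ?N (\<lambda>a b c d. ((odd a \<and> odd c \<and> odd d) \<and> (a + c) mod 4 = 0) \<and> \<not> c < a)"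
      by (rule num_decomps_split)
    also have "?N (\<lambda>a b c d. ((odd a \<and> odd c \<and> odd d) \<and> (a + c) mod 4 = 0) \<and> c < a)
        = ?N (\<lambda>a b c d. c < a \<and> (\<lambda>a b c d. sheared a c d \<and> even b) (a - c) b c (b + d))"
    proof (rule num_decomps_cong)
      fix a b c d assume *: "(a, b, c, d) \<in> decomps n"
      show "(((odd a \<and> odd c \<and> odd d) \<and> (a + c) mod 4 = 0) \<and> c < a)
          \<longleftrightarrow> (c < a \<and> (\<lambda>a b c d. sheared a c d \<and> even b) (a - c) b c (b + d))"
        using mod4[of c a] odd_n[OF *] by auto
    qed
    also have "\<dots> = ?N (\<lambda>a b c d. b < d \<and> sheared a c d \<and> even b)"
      by (rule num_decomps_shear)
    also have "?N (\<lambda>a b c d. ((odd a \<and> odd c \<and> odd d) \<and> (a + c) mod 4 = 0) \<and> \<not> c < a)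
        = ?N (\<lambda>a b c d. ((odd c \<and> odd a \<and> odd b) \<and> (c + a) mod 4 = 0) \<and> \<not> a < c)"
      by (rule num_decomps_swap)
    also have "\<dots> = ?N (\<lambda>a b c d. c < a \<and> (\<lambda>a b c d. sheared a c d \<and> odd b) (a - c) b c (b + d))"
    proof (rule num_decomps_cong)
      fix a b c d assume *: "(a, b, c, d) \<in> decomps n"
      then have "even d" if "odd a \<and> odd b \<and> odd c"
        using that assms by (auto simp: decomps_def)
      moreover have "(2 * a) mod 4 \<noteq> 0" if "odd a"
        using that by presburger
      ultimately show "(((odd c \<and> odd a \<and> odd b) \<and> (c + a) mod 4 = 0) \<and> \<not> a < c)
          \<longleftrightarrow> (c < a \<and> (\<lambda>a b c d. sheared a c d \<and> odd b) (a - c) b c (b + d))"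
        using mod4[of c a] by (cases "a = c") (auto simp: add.commute mult_2 not_less)
    qed
    also have "\<dots> = ?N (\<lambda>a b c d. b < d \<and> sheared a c d \<and> odd b)"
      by (rule num_decomps_shear)
    also have "?N (\<lambda>a b c d. b < d \<and> sheared a c d \<and> even b) + \<dots> = ?N (\<lambda>a b c d. sheared a c d \<and> b < d)"
      by (subst num_decomps_split[of n "\<lambda>a b c d. sheared a c d \<and> b < d" "\<lambda>a b c d. even b"])
         (simp add: conj_ac)
    finally show ?thesis .
  qed
  have mod4': "odd a \<and> odd c \<and> (a + c) mod 4 \<noteq> 0 \<longleftrightarrow> (a + c) mod 4 = 2 \<and> odd c" for a c :: nat
  proof -
    have "even t \<Longrightarrow> t mod 4 \<noteq> 0 \<longleftrightarrow> t mod 4 = 2" for t :: nat by presburger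
    from this[of "a + c"] even_mod[of "a + c"] show ?thesis by auto
  qed
  have Q2: "?N (\<lambda>a b c d. (odd a \<and> odd c \<and> odd d) \<and> (a + c) mod 4 \<noteq> 0) = ?N (\<lambda>a b c d. sheared a c d \<and> c < a)"
  proof -
    let ?P = "\<lambda>a b c d. odd a \<and> odd c \<and> odd d \<and> even b \<and> (a + c) mod 4 = 2"
    let ?P' = "\<lambda>a b c d. odd a \<and> odd b \<and> odd c \<and> even d \<and> (a + c) mod 4 = 2"
    have "?N (\<lambda>a b c d. (odd a \<and> odd c \<and> odd d) \<and> (a + c) mod 4 \<noteq> 0) = ?N ?P"
      by (rule num_decomps_cong) (use odd_n mod4' in blast)
    also have "\<dots> = ?N (\<lambda>a b c d. ?P a b c d \<and> b < d) + ?N (\<lambda>a b c d. ?P a b c d \<and> \<not> b < d)"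
      by (rule num_decomps_split)
    also have "?N (\<lambda>a b c d. ?P a b c d \<and> b < d) = ?N (\<lambda>a b c d. b < d \<and> ?P a b c d)"
      by (simp only: conj_ac)
    also have "\<dots> = ?N (\<lambda>a b c d. c < a \<and> ?P (a - c) b c (b + d))"
      by (rule num_decomps_shear[symmetric])
    also have "\<dots> = ?N (\<lambda>a b c d. (sheared a c d \<and> c < a) \<and> even b)"
      by (rule num_decomps_cong) (auto dest: even_mod)
    also have "?N (\<lambda>a b c d. ?P a b c d \<and> \<not> b < d) = ?N (\<lambda>a b c d. ?P c d a b \<and> \<not> d < b)"
      by (rule num_decomps_swap)
    also have "\<dots> = ?N (\<lambda>a b c d. b < d \<and> ?P' a b c d)"
      by (rule num_decomps_cong) (auto simp: add.commute not_less le_less)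
    also have "\<dots> = ?N (\<lambda>a b c d. c < a \<and> ?P' (a - c) b c (b + d))"
      by (rule num_decomps_shear[symmetric])
    also have "\<dots> = ?N (\<lambda>a b c d. (sheared a c d \<and> c < a) \<and> \<not> even b)"
      by (rule num_decomps_cong) (auto dest: even_mod)
    also have "?N (\<lambda>a b c d. (sheared a c d \<and> c < a) \<and> even b) + \<dots> = ?N (\<lambda>a b c d. sheared a c d \<and> c < a)"
      by (rule num_decomps_split[symmetric])
    finally show ?thesis .
  qed
  have V1: "?N (\<lambda>a b c d. sheared a c d \<and> \<not> c < a) = ?N (\<lambda>a b c d. sheared a c d \<and> d < b)"
  proof -
    have "?N (\<lambda>a b c d. sheared a c d \<and> \<not> c < a) = ?N (\<lambda>a b c d. sheared c a b \<and> \<not> a < c)"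
      by (rule num_decomps_swap)
    also have "\<dots> = ?N (\<lambda>a b c d. c < a \<and> sheared c (a - c) b)"
      by (rule num_decomps_cong) (auto dest: even_mod simp: not_less le_less)
    also have "\<dots> = ?N (\<lambda>a b c d. b < d \<and> sheared c a b)"
      by (rule num_decomps_shear)
    also have "\<dots> = ?N (\<lambda>a b c d. d < b \<and> sheared a c d)"
      by (rule num_decomps_swap)
    finally show ?thesis by (simp only: conj_commute)
  qed
  have V2: "?N (\<lambda>a b c d. sheared a c d) = ?N (\<lambda>a b c d. sheared a c d \<and> c < a) + ?N (\<lambda>a b c d. sheared a c d \<and> \<not> c < a)"
    by (rule num_decomps_split)
  have V3: "?N (\<lambda>a b c d. sheared a c d) = ?N (\<lambda>a b c d. sheared a c d \<and> b < d) + ?N (\<lambda>a b c d. sheared a c d \<and> \<not> b < d)"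
    by (rule num_decomps_split)
  have "?N (\<lambda>a b c d. sheared a c d \<and> \<not> b < d) = ?N (\<lambda>a b c d. (sheared a c d \<and> \<not> b < d) \<and> b = d)
      + ?N (\<lambda>a b c d. (sheared a c d \<and> \<not> b < d) \<and> b \<noteq> d)"
    by (rule num_decomps_split)
  also have "?N (\<lambda>a b c d. (sheared a c d \<and> \<not> b < d) \<and> b = d) = ?N (\<lambda>a b c d. sheared a c d \<and> b = d)"
    by (rule num_decomps_cong) auto
  also have "?N (\<lambda>a b c d. (sheared a c d \<and> \<not> b < d) \<and> b \<noteq> d) = ?N (\<lambda>a b c d. sheared a c d \<and> d < b)"
    by (rule num_decomps_cong) auto
  finally have "?N (\<lambda>a b c d. odd a \<and> odd c \<and> odd d) + ?N (\<lambda>a b c d. sheared a c d \<and> b = d)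
      + 2 * ?N (\<lambda>a b c d. sheared a c d \<and> d < b) = 2 * ?N (\<lambda>a b c d. sheared a c d)"
    using Q Q1 Q2 V1 V2 V3 by linarith
  then show ?thesis by (rule parity)
qed

section \<open>The logarithmic derivative modulo 16\<close>

text \<open>For \<open>k > 0\<close> this is congruent modulo 2 to the divisor sum \<open>\<sigma>(k)\<close>. The value at 0 is 0 because the set is then infinite.\<close>

definition num_odd_divisors :: "nat \<Rightarrow> nat" where
  "num_odd_divisors k = card {a. odd a \<and> a dvd k}"

text \<open>Modulo 2 this is \<open>\<sigma>\<^sup>*\<close>, because the cube of \<open>d\<close> is odd exactly for odd \<open>d\<close>.\<close>

definition num_odd_factorizations :: "nat \<Rightarrow> nat" where
  "num_odd_factorizations m = card {c. odd c \<and> c dvd m \<and> odd (m div c)}"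

lemma num_odd_divisors_0: "num_odd_divisors 0 = 0"
proof -
  have "infinite (range (\<lambda>k :: nat. 2 * k + 1))"
    by (rule range_inj_infinite) (simp add: inj_def)
  then have "infinite {a :: nat. odd a}"
    by (rule infinite_super[rotated]) auto
  then show ?thesis by (simp add: num_odd_divisors_def)
qed

lemma sigma_star_0: "sigma_star_2_3 0 = 0"
  by (simp add: sigma_star_2_3_def)

lemma num_decomps_conv_sum:
  "num_decomps n (\<lambda>a b c d. odd a \<and> odd c \<and> odd d)
     = (\<Sum>k\<le>n. num_odd_divisors k * num_odd_factorizations (n - k))"
proof -
  define A where "A k = {a. odd a \<and> a dvd k}" for k :: nat
  define B where "B m = {c. odd c \<and> c dvd m \<and> odd (m div c)}" for m :: nat
  have fin: "finite (A k)" "finite (B k)" if "k > 0" for k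
    using that by (auto simp: A_def B_def intro: finite_subset[OF _ finite_divisors_nat])
  have "num_decomps n (\<lambda>a b c d. odd a \<and> odd c \<and> odd d) = card (SIGMA k:{0<..<n}. A k \<times> B (n - k))"
    (is "card ?L = card ?R")
  proof (rule bij_betw_same_card[OF bij_betw_byWitness[
          where f = "\<lambda>(a, b, c, d). (a * b, (a, c))"
            and f' = "\<lambda>(k, (a, c)). (a, k div a, c, (n - k) div c)"]])
    show "(\<lambda>(k, (a, c)). (a, k div a, c, (n - k) div c)) ` ?R \<subseteq> ?L"
    proof clarify
      fix k a c assume k: "k \<in> {0<..<n}" and a: "a \<in> A k" and c: "c \<in> B (n - k)"
      obtain b where b: "k = a * b" using a by (auto simp: A_def)
      obtain d where d: "n - k = c * d" using c by (auto simp: B_def)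
      have pos: "a > 0" "b > 0" "c > 0" "d > 0"
        using k b d by (auto intro!: gr0I)
      have div: "k div a = b" "(n - k) div c = d"
        using pos by (simp_all add: d) (simp add: b)
      have "a * b + c * d = n" using k by (simp flip: b d)
      then show "(a, k div a, c, (n - k) div c) \<in> decomps n
          \<and> odd a \<and> odd c \<and> odd ((n - k) div c)"
        using pos a c unfolding div by (simp add: A_def B_def decomps_def div)
    qed
  qed (auto simp: decomps_def A_def B_def)
  also have "\<dots> = (\<Sum>k\<in>{0<..<n}. num_odd_divisors k * num_odd_factorizations (n - k))"
    by (subst card_SigmaI)
       (auto simp: fin card_cartesian_product A_def B_def num_odd_divisors_def num_odd_factorizations_def)
  also have "\<dots> = (\<Sum>k\<le>n. num_odd_divisors k * num_odd_factorizations (n - k))"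
  proof (rule sum.mono_neutral_left)
    note num_odd_divisors_0
    moreover have "num_odd_factorizations 0 = 0" by (simp add: num_odd_factorizations_def)
    ultimately show "\<forall>k\<in>{..n} - {0<..<n}. num_odd_divisors k * num_odd_factorizations (n - k) = 0"
      by (auto simp: not_less)
  qed auto
  finally show ?thesis .
qed

lemma even_sum_mult_right_cong:
  fixes f g h :: "'a \<Rightarrow> nat"
  assumes "\<And>k. k \<in> A \<Longrightarrow> even (g k) \<longleftrightarrow> even (h k)"
  shows "even (\<Sum>k\<in>A. f k * g k) \<longleftrightarrow> even (\<Sum>k\<in>A. f k * h k)"
proof -
  have "[(\<Sum>k\<in>A. f k * g k) = (\<Sum>k\<in>A. f k * h k)] (mod 2)"
    using assms by (intro cong_sum cong_mult) (auto simp: cong_def parity_cases mod_2_eq_odd)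
  then show ?thesis by (simp add: cong_def even_iff_mod_2_eq_zero)
qed

lemma sigma_star_parity: "even (sigma_star_2_3 m) \<longleftrightarrow> even (num_odd_factorizations m)"
proof (cases "m = 0")
  case False
  then have fin: "finite {d. 0 < d \<and> d dvd m \<and> \<not> 2 dvd (m div d)}"
    by (auto intro: finite_subset[OF _ finite_divisors_nat])
  have "{c. odd c \<and> c dvd m \<and> odd (m div c)}
      = {d \<in> {d. 0 < d \<and> d dvd m \<and> \<not> 2 dvd (m div d)}. odd (d ^ 3)}"
    by (auto intro: odd_pos)
  with fin show ?thesis
    by (simp only: sigma_star_2_3_def num_odd_factorizations_def even_sum_iff)
qed (simp add: sigma_star_2_3_def num_odd_factorizations_def)

lemma sigma_star_double: "sigma_star_2_3 (2 * m) = 8 * sigma_star_2_3 m"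
proof -
  have "(\<Sum>d | 0 < d \<and> d dvd m \<and> \<not> 2 dvd (m div d). (2 * d) ^ 3)
      = (\<Sum>d | 0 < d \<and> d dvd 2 * m \<and> \<not> 2 dvd (2 * m div d). d ^ 3)"
  proof (rule sum.reindex_bij_witness[of _ "\<lambda>d. d div 2" "\<lambda>d. 2 * d"])
    fix d assume d: "d \<in> {d. 0 < d \<and> d dvd 2 * m \<and> \<not> 2 dvd (2 * m div d)}"
    then obtain e where e: "2 * m = d * e" by (auto elim: dvdE)
    with d have "odd e" by auto
    moreover have "even (d * e)" by (simp flip: e)
    ultimately obtain d' where d': "d = 2 * d'" by auto
    with e have "m = d' * e" by simp
    with d d' \<open>odd e\<close> show "d div 2 \<in> {d. 0 < d \<and> d dvd m \<and> \<not> 2 dvd (m div d)}"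
      "2 * (d div 2) = d" by auto
  qed auto
  then show ?thesis
    by (simp add: sigma_star_2_3_def power_mult_distrib sum_distrib_left)
qed

lemma card_2_mod_4: "card {a. a < m \<and> a mod 4 = 2} = (m + 1) div (4::nat)"
proof (induction m)
  case (Suc m)
  have "{a. a < Suc m \<and> a mod 4 = 2}
      = (if m mod 4 = 2 then insert m {a. a < m \<and> a mod 4 = 2} else {a. a < m \<and> a mod 4 = 2})"
    by (auto simp: less_Suc_eq)
  moreover have "finite {a. a < m \<and> a mod 4 = 2}" by simp
  moreover have "(Suc m + 1) div 4 = (if m mod 4 = 2 then Suc ((m + 1) div 4) else (m + 1) div 4)"
    by presburger
  ultimately show ?case using Suc by simp
qed simp

text \<open>On the diagonal \<open>n = (a + c) b\<close>, so \<open>m = a + c\<close> is a divisor of \<open>n\<close>, and for each divisor only the choice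
of \<open>a < m\<close> remains.\<close>

lemma num_decomps_diagonal:
  assumes "odd n"
  shows "num_decomps n (\<lambda>a b c d. sheared a c d \<and> b = d) = (\<Sum>m | m dvd n. (m + 1) div 4)"
proof -
  have n: "n > 0" using assms by (rule odd_pos)
  have "num_decomps n (\<lambda>a b c d. sheared a c d \<and> b = d)
      = card (SIGMA m:{m. m dvd n}. {a. a < m \<and> a mod 4 = 2})"
  proof (rule bij_betw_same_card[OF bij_betw_byWitness[where f = "\<lambda>(a, b, c, d). (a + c, a)"
        and f' = "\<lambda>(m, a). (a, n div m, m - a, n div m)"]])
    show "\<forall>t\<in>{(a, b, c, d). (a, b, c, d) \<in> decomps n \<and> sheared a c d \<and> b = d}.
        (\<lambda>(m, a). (a, n div m, m - a, n div m)) ((\<lambda>(a, b, c, d). (a + c, a)) t) = t"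
      by (auto simp: decomps_def simp flip: add_mult_distrib)
    show "\<forall>t\<in>SIGMA m:{m. m dvd n}. {a. a < m \<and> a mod 4 = 2}.
        (\<lambda>(a, b, c, d). (a + c, a)) ((\<lambda>(m, a). (a, n div m, m - a, n div m)) t) = t"
      by auto
    show "(\<lambda>(a, b, c, d). (a + c, a)) ` {(a, b, c, d). (a, b, c, d) \<in> decomps n \<and> sheared a c d \<and> b = d}
        \<subseteq> (SIGMA m:{m. m dvd n}. {a. a < m \<and> a mod 4 = 2})"
      by (auto simp: decomps_def simp flip: add_mult_distrib)
    show "(\<lambda>(m, a). (a, n div m, m - a, n div m)) ` (SIGMA m:{m. m dvd n}. {a. a < m \<and> a mod 4 = 2})
        \<subseteq> {(a, b, c, d). (a, b, c, d) \<in> decomps n \<and> sheared a c d \<and> b = d}"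
    proof clarify
      fix m a assume m: "m dvd n" and a: "a < m" "a mod 4 = 2"
      obtain e where e: "n = m * e" using m by (elim dvdE)
      have "odd m" "odd e" "e > 0" "m > 0" using assms n by (auto simp: e)
      moreover have "a > 0" "even a" using a by presburger+
      moreover have "a * e + (m - a) * e = m * e"
        using a by (simp flip: add_mult_distrib)
      ultimately show "(a, n div m, m - a, n div m) \<in> decomps n
          \<and> sheared a (m - a) (n div m) \<and> n div m = n div m"
        using a by (auto simp: decomps_def e)
    qed
  qed
  also have "\<dots> = (\<Sum>m | m dvd n. (m + 1) div 4)"
    using n by (subst card_SigmaI) (auto simp: card_2_mod_4)
  finally show ?thesis .
qed

lemma odd_square_mod_16: "odd d \<Longrightarrow> [8 * int ((d + 1) div 4) = int d ^ 2 - 1] (mod 16)"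
proof -
  assume "odd d"
  then obtain j where d: "d = 2 * j + 1" by (elim oddE)
  show ?thesis
  proof (cases "even j")
    case True
    then obtain k where "j = 2 * k" by (elim evenE)
    with d have k: "d = 4 * k + 1" by simp
    then have "(d + 1) div 4 = k" by simp
    then have "8 * int ((d + 1) div 4) - (int d ^ 2 - 1) = 16 * - (int k ^ 2)"
      by (simp add: k power2_eq_square algebra_simps)
    then show ?thesis by (simp only: cong_iff_dvd_diff dvd_triv_left)
  next
    case False
    then obtain k where "j = 2 * k + 1" by (elim oddE)
    with d have k: "d = 4 * k + 3" by simp
    then have "(d + 1) div 4 = k + 1" by simp
    then have "8 * int ((d + 1) div 4) - (int d ^ 2 - 1) = 16 * - (int k ^ 2 + int k)"
      by (simp add: k power2_eq_square algebra_simps)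
    then show ?thesis by (simp only: cong_iff_dvd_diff dvd_triv_left)
  qed
qed

text \<open>Both sides are sums over \<open>n = d e\<close>. Modulo 16 their terms differ by \<open>e - d\<close>, since
\<open>(n - 1) d^3 - (d^2 - 1) - (e - d) = e (d^4 - 1) + (1 - d^2) (1 + d)\<close> and \<open>8 | d^2 - 1\<close>; and the
\<open>e - d\<close> cancel in the sum because \<open>d \<mapsto> e\<close> permutes the divisors.\<close>

lemma odd_sigma_star_mod_16:
  assumes "odd n"
  shows "[(int n - 1) * int (sigma_star_2_3 n) = 8 * int (\<Sum>m | m dvd n. (m + 1) div 4)] (mod 16)"
proof -
  have n: "n > 0" using assms by (rule odd_pos)
  have sigma: "sigma_star_2_3 n = (\<Sum>d | d dvd n. d ^ 3)"
    unfolding sigma_star_2_3_def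
    by (rule sum.cong) (use assms n in \<open>auto elim!: dvdE\<close>)
  have "[(int n - 1) * int d ^ 3 = 8 * int ((d + 1) div 4) + (int (n div d) - int d)] (mod 16)"
    if dvd: "d dvd n" for d
  proof -
    obtain e where e: "n = d * e" using dvd by (elim dvdE)
    have d: "odd d" "d > 0" using assms n e by auto
    then obtain j where j: "int d = 2 * j + 1"
      by (metis even_of_nat oddE)
    have "even (j * (j + 1))" by simp
    then obtain l where l: "j * (j + 1) = 2 * l" by (elim evenE)
    have sq: "int d ^ 2 = 8 * l + 1"
      using l by (simp add: j power2_eq_square algebra_simps)
    have "(int n - 1) * int d ^ 3 - (int d ^ 2 - 1 + (int e - int d))
        = int e * ((int d ^ 2)\<^sup>2 - 1) + (1 - int d ^ 2) * (1 + int d)"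
      by (simp add: e algebra_simps power2_eq_square power3_eq_cube)
    also have "\<dots> = 16 * (int e * (4 * l ^ 2 + l) - l * (j + 1))"
      unfolding sq by (simp add: j algebra_simps power2_eq_square)
    finally have "[(int n - 1) * int d ^ 3 = int d ^ 2 - 1 + (int e - int d)] (mod 16)"
      by (simp add: cong_iff_dvd_diff)
    also have "[int d ^ 2 - 1 + (int e - int d) = 8 * int ((d + 1) div 4) + (int e - int d)] (mod 16)"
      using odd_square_mod_16[OF d(1)] by (intro cong_add) (auto simp: cong_sym)
    also have "e = n div d" using d by (simp add: e)
    finally show ?thesis .
  qed
  then have "[(\<Sum>d | d dvd n. (int n - 1) * int d ^ 3)
      = (\<Sum>d | d dvd n. 8 * int ((d + 1) div 4) + (int (n div d) - int d))] (mod 16)"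
    by (intro cong_sum) auto
  moreover have "(\<Sum>d | d dvd n. int (n div d)) = (\<Sum>d | d dvd n. int d)"
    by (rule sum.reindex_bij_witness[of _ "\<lambda>d. n div d" "\<lambda>d. n div d"])
       (use n in \<open>auto elim!: dvdE\<close>)
  ultimately show ?thesis
    by (simp add: sigma sum_distrib_left sum.distrib sum_subtractf)
qed

text \<open>Here \<open>a, b, c, d\<close> are all odd, and exchanging the products leaves only \<open>a b = c d = m\<close> with \<open>a = c\<close>,
\<open>b = d\<close> unpaired.\<close>

lemma even_decomps_parity:
  assumes "m > 0"
  shows "even (num_decomps (2 * m) (\<lambda>a b c d. odd a \<and> odd c \<and> odd d))
     \<longleftrightarrow> even (num_odd_factorizations m)"
proof -
  let ?N = "num_decomps (2 * m)"
  let ?P = "\<lambda>a b c d. odd a \<and> odd b \<and> odd c \<and> odd d"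
  let ?P' = "\<lambda>a b c d. ?P a b c d \<and> \<not> a < c \<and> \<not> c < a"
  have 1: "?N (\<lambda>a b c d. odd a \<and> odd c \<and> odd d) = ?N ?P"
  proof (rule num_decomps_cong)
    fix a b c d assume "(a, b, c, d) \<in> decomps (2 * m)"
    then have "a * b + c * d = 2 * m" by (simp add: decomps_def)
    then have "even (a * b + c * d)" by simp
    then show "(odd a \<and> odd c \<and> odd d) = ?P a b c d" by auto
  qed
  have 2: "even (?N ?P) \<longleftrightarrow> even (?N ?P')"
    by (rule num_decomps_antisym[where P = ?P and R = "\<lambda>a b c d. a < c"]) auto
  have 3: "even (?N ?P') \<longleftrightarrow> even (?N (\<lambda>a b c d. ?P' a b c d \<and> \<not> b < d \<and> \<not> d < b))"
    by (rule num_decomps_antisym[where P = ?P' and R = "\<lambda>a b c d. b < d"]) auto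
  have 4: "?N (\<lambda>a b c d. ?P' a b c d \<and> \<not> b < d \<and> \<not> d < b) = num_odd_factorizations m"
    (is "card ?L = _")
    unfolding num_odd_factorizations_def
  proof (rule bij_betw_same_card[OF bij_betw_byWitness[where f = "\<lambda>(a, b, c, d). a"
          and f' = "\<lambda>a. (a, m div a, a, m div a)"]])
    have "a = c \<and> b = d \<and> m = a * b \<and> a > 0 \<and> odd a \<and> odd b" if "(a, b, c, d) \<in> ?L" for a b c d
    proof -
      have "a = c" "b = d" "a * b + c * d = 2 * m" "a > 0" "odd a" "odd b"
        using that by (auto simp: decomps_def)
      then show ?thesis by simp
    qed
    note L = this
    show "\<forall>t\<in>?L. (\<lambda>a. (a, m div a, a, m div a)) ((\<lambda>(a, b, c, d). a) t) = t"
      using L by fastforce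
    show "(\<lambda>(a, b, c, d). a) ` ?L \<subseteq> {c. odd c \<and> c dvd m \<and> odd (m div c)}"
      using L by fastforce
    show "(\<lambda>a. (a, m div a, a, m div a)) ` {c. odd c \<and> c dvd m \<and> odd (m div c)} \<subseteq> ?L"
      using assms by (auto simp: decomps_def odd_pos)
  qed auto
  show ?thesis unfolding 1 2 3 4 by (rule refl)
qed

text \<open>This is \<open>\<theta>E \<equiv> E (1 + 8 R)\<close> modulo 16, where \<open>\<theta> = q d/dq\<close> and \<open>R\<close> is the generating series of
\<open>num_odd_divisors\<close>. As \<open>\<sigma>\<^sup>*\<close> is divisible by 8 at even arguments, where moreover \<open>n - 1\<close> is odd, the
even case comes down to a parity, like the odd one.\<close>

theorem sigma_star_convolution_mod_16:
  "[(int n - 1) * int (sigma_star_2_3 n)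
     = 8 * int (\<Sum>k\<le>n. num_odd_divisors k * sigma_star_2_3 (n - k))] (mod 16)"
proof -
  let ?Q = "num_decomps n (\<lambda>a b c d. odd a \<and> odd c \<and> odd d)"
  let ?S = "\<Sum>k\<le>n. num_odd_divisors k * sigma_star_2_3 (n - k)"
  have cong8: "[8 * int x = 8 * int y] (mod 16)" if "even x \<longleftrightarrow> even y" for x y
  proof -
    have "even (int x - int y)" using that by simp
    then obtain k where "int x - int y = 2 * k" by (elim evenE)
    then have "8 * int x - 8 * int y = 16 * k" by simp
    then show ?thesis by (simp only: cong_iff_dvd_diff dvd_triv_left)
  qed
  have "even ?S \<longleftrightarrow> even ?Q"
    unfolding num_decomps_conv_sum
    by (rule even_sum_mult_right_cong) (rule sigma_star_parity)
  then have SQ: "[8 * int ?Q = 8 * int ?S] (mod 16)"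
    by (intro cong8) simp
  have "[(int n - 1) * int (sigma_star_2_3 n) = 8 * int ?Q] (mod 16)"
  proof (cases "even n")
    case True
    then obtain m where m: "n = 2 * m" by (elim evenE)
    show ?thesis
    proof (cases "m = 0")
      case True
      then have "{(a, b, c, d) \<in> decomps n. odd a \<and> odd c \<and> odd d} = {}"
        by (auto simp: m decomps_def)
      then have "?Q = 0" by (simp only: card.empty)
      show ?thesis unfolding \<open>?Q = 0\<close> using True by (simp add: m sigma_star_0)
    next
      case False
      have "(int n - 1) * int (sigma_star_2_3 n) = 8 * int (sigma_star_2_3 m) + 16 * ((int m - 1) * int (sigma_star_2_3 m))"
        unfolding m sigma_star_double by (simp add: algebra_simps)
      then have "[(int n - 1) * int (sigma_star_2_3 n) = 8 * int (sigma_star_2_3 m)] (mod 16)"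
        by (simp add: cong_iff_dvd_diff)
      also have "[8 * int (sigma_star_2_3 m) = 8 * int ?Q] (mod 16)"
        using even_decomps_parity[of m] False by (intro cong8) (simp add: m sigma_star_parity)
      finally show ?thesis .
    qed
  next
    case False
    note odd_sigma_star_mod_16[OF False]
    also have "[8 * int (\<Sum>m | m dvd n. (m + 1) div 4) = 8 * int ?Q] (mod 16)"
      using odd_decomps_parity[OF False] num_decomps_diagonal[OF False] by (intro cong8) simp
    finally show ?thesis .
  qed
  also note SQ
  finally show ?thesis .
qed

section \<open>Negative powers of a series\<close>

text \<open>The hypothesis says \<open>j f_j = 2^x g_j\<close>, and \<open>2^x\<close> does not divide \<open>j\<close>.\<close>

lemma even_coeff_of_power_of_two_exponent:
  fixes f g :: "int fps"
  assumes deriv: "fps_X * fps_deriv f = of_nat (2 ^ x) * g"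
    and j: "0 < j" "j < 2 ^ x"
  shows "even (f $ j)"
proof (rule ccontr)
  assume odd: "odd (f $ j)"
  have "int j * f $ j = (fps_X * fps_deriv f) $ j"
    using j by simp
  also have "\<dots> = 2 ^ x * g $ j"
    unfolding deriv by (simp flip: fps_of_nat)
  finally have "2 ^ x dvd int j * f $ j" by simp
  moreover have "coprime (2 ^ x) (f $ j)" using odd by simp
  ultimately have "2 ^ x dvd int j" by (simp add: coprime_dvd_mult_left_iff)
  then have "2 ^ x dvd j" by (metis of_nat_dvd_iff of_nat_numeral of_nat_power)
  then show False using j by (auto dest: dvd_imp_le)
qed

text \<open>Put \<open>H = G^s = F^(-s)\<close> with \<open>s = 2^x\<close>. If \<open>\<theta>F = 8 R F + 16 K\<close> then \<open>\<theta>H = -s (8 R H + 16 K G H)\<close>. Comparing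
coefficients at \<open>s\<close>, the factor \<open>s\<close> cancels and \<open>H_s \<equiv> -8 (R H)_s\<close> modulo 16. The same equation forces
\<open>H_j\<close> to be even for \<open>0 < j < s\<close>, so only \<open>R_s H_0\<close> contributes to the parity of \<open>(R H)_s\<close>.\<close>

lemma inverse_power_coeff_mod_16:
  fixes F G R :: "int fps"
  assumes FG: "F * G = 1" and F0: "F $ 0 = 1"
    and deriv: "\<And>n. [int n * F $ n = 8 * (R * F) $ n] (mod 16)"
    and R0: "R $ 0 = 0" and Rs: "odd (R $ (2 ^ x))"
  shows "[(G ^ (2 ^ x)) $ (2 ^ x) = 8] (mod 16)"
proof -
  define s :: nat where "s = 2 ^ x"
  have s: "s > 0" by (simp add: s_def)
  define H where "H = G ^ s"
  \<comment> \<open>The series \<open>K\<close> collects the multiples of 16 in the congruence for \<open>\<theta>F\<close>.\<close>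
  define K where "K = Abs_fps (\<lambda>n. (int n * F $ n - 8 * (R * F) $ n) div 16)"
  have K: "int n * F $ n = 8 * (R * F) $ n + 16 * K $ n" for n
    using deriv[of n] by (simp add: K_def cong_iff_dvd_diff)
  have dF: "fps_X * fps_deriv F = 8 * (R * F) + 16 * K"
  proof (rule fps_ext)
    fix n show "(fps_X * fps_deriv F) $ n = (8 * (R * F) + 16 * K) $ n"
      using K[of n] by (cases n) (simp_all add: numeral_fps_const)
  qed
  have "fps_deriv (F * G) = 0" by (simp add: FG)
  then have "fps_deriv F * G + F * fps_deriv G = 0" by (simp add: add.commute mult.commute)
  then have dG: "F * fps_deriv G = - (fps_deriv F * G)" by (simp add: eq_neg_iff_add_eq_0 add.commute)
  have "fps_X * fps_deriv H = of_nat s * (fps_X * (F * G) * fps_deriv G * G ^ (s - 1))"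
    by (simp add: H_def fps_deriv_power FG fps_of_nat)
  also have "\<dots> = of_nat s * (fps_X * G * (F * fps_deriv G) * G ^ (s - 1))"
    by (simp only: mult_ac)
  also have "\<dots> = of_nat s * (- (G * (fps_X * fps_deriv F) * (G * G ^ (s - 1))))"
    by (simp add: dG mult_ac)
  also have "G * G ^ (s - 1) = H"
    using s by (simp add: H_def power_eq_if)
  also have "G * (fps_X * fps_deriv F) * H = 8 * (R * (F * G) * H) + 16 * (K * G * H)"
    unfolding dF by (simp add: algebra_simps)
  finally have dH: "fps_X * fps_deriv H = of_nat s * - (8 * (R * H) + 16 * (K * G * H))"
    by (simp add: FG)

  have "G $ 0 = 1"
    using arg_cong[OF FG, of "\<lambda>f. fps_nth f 0"] F0 by simp
  then have H0: "H $ 0 = 1" by (simp add: H_def fps_power_zeroth)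
  have even: "even (H $ j)" if "0 < j" "j < s" for j
    using even_coeff_of_power_of_two_exponent dH that unfolding s_def by blast
  have "(R * H) $ s = (\<Sum>i\<le>s. R $ i * H $ (s - i))"
    by (simp add: fps_mult_nth atMost_atLeast0)
  also have "\<dots> = R $ s * H $ 0 + (\<Sum>i\<in>{..s} - {s}. R $ i * H $ (s - i))"
    by (subst sum.remove[of _ s]) auto
  finally have RH: "(R * H) $ s = R $ s + (\<Sum>i\<in>{..s} - {s}. R $ i * H $ (s - i))"
    by (simp add: H0)
  have "even (R $ i * H $ (s - i))" if "i \<in> {..s} - {s}" for i
    using that even[of "s - i"] R0 by (cases "i = 0") auto
  then have "even (\<Sum>i\<in>{..s} - {s}. R $ i * H $ (s - i))"
    by (rule dvd_sum)
  then have "odd ((R * H) $ s)" using RH Rs by (simp add: s_def)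
  then obtain m where m: "(R * H) $ s = 2 * m + 1" by (elim oddE)

  have "int s * H $ s = (fps_X * fps_deriv H) $ s" using s by simp
  also have "\<dots> = int s * - (8 * (R * H) $ s + 16 * (K * G * H) $ s)"
    unfolding dH by (simp add: numeral_fps_const flip: fps_of_nat)
  finally have "H $ s = - (8 * (R * H) $ s + 16 * (K * G * H) $ s)"
    using s by simp
  then have "H $ s - 8 = 16 * - (m + 1 + (K * G * H) $ s)"
    using m by simp
  then show ?thesis
    unfolding H_def s_def by (simp only: cong_iff_dvd_diff dvd_triv_left)
qed

section \<open>The coefficient of \<open>q^s\<close> in \<open>F^(-s)\<close>\<close>

definition shifted_eisenstein_fps :: "int fps" where
  "shifted_eisenstein_fps = Abs_fps (\<lambda>n. int (sigma_star_2_3 (n + 1)))"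

lemma shifted_eisenstein_fps_nth_0: "shifted_eisenstein_fps $ 0 = 1"
proof -
  have "{d :: nat. 0 < d \<and> d dvd 1 \<and> \<not> 2 dvd (1 div d)} = {1}" by auto
  then show ?thesis by (simp add: shifted_eisenstein_fps_def sigma_star_2_3_def)
qed

lemma num_odd_divisors_power_of_two: "num_odd_divisors (2 ^ x) = 1"
proof -
  have "a = 1" if "odd a" "a dvd 2 ^ x" for a :: nat
    using that by (metis coprime_common_divisor coprime_power_right_iff coprime_right_2_iff_odd
        dvd_refl nat_dvd_1_iff_1)
  then have "{a :: nat. odd a \<and> a dvd 2 ^ x} = {1}" by auto
  then show ?thesis by (simp add: num_odd_divisors_def)
qed

lemma shifted_eisenstein_inverse_power_coeff:
  fixes G :: "int fps"
  assumes "shifted_eisenstein_fps * G = 1"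
  shows "[(G ^ (2 ^ x)) $ (2 ^ x) = 8] (mod 16)"
proof (rule inverse_power_coeff_mod_16[OF assms shifted_eisenstein_fps_nth_0])
  define R where "R = Abs_fps (\<lambda>n. int (num_odd_divisors n))"
  show "R $ 0 = 0" by (simp add: R_def num_odd_divisors_0)
  show "odd (R $ (2 ^ x))" by (simp add: R_def num_odd_divisors_power_of_two)
  fix n
  have "int (\<Sum>k\<le>n + 1. num_odd_divisors k * sigma_star_2_3 (n + 1 - k)) = (R * shifted_eisenstein_fps) $ n"
    by (simp add: fps_mult_nth atMost_atLeast0 R_def shifted_eisenstein_fps_def sigma_star_0 Suc_diff_le)
  then show "[int n * shifted_eisenstein_fps $ n = 8 * (R * shifted_eisenstein_fps) $ n] (mod 16)"
    using sigma_star_convolution_mod_16[of "n + 1"] by (simp add: shifted_eisenstein_fps_def)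
qed

lemma ord2_of_int_eq_3:
  assumes "[m = 8] (mod 16)"
  shows "ord2 (of_int m) = 3"
proof -
  have "16 dvd m - 8" using assms by (simp add: cong_iff_dvd_diff)
  then obtain k where k: "m - 8 = 16 * k" by (elim dvdE)
  then have m: "m = 2 ^ 3 * (2 * k + 1)" by simp
  have "multiplicity 2 m = 3"
  proof (rule multiplicity_eqI)
    show "2 ^ 3 dvd m" unfolding m by simp
    show "\<not> 2 ^ Suc 3 dvd m" unfolding m power_Suc2 dvd_mult_cancel_left by simp
  qed
  moreover have "m \<noteq> 0" using k by presburger
  moreover have "quotient_of (of_int m) = (m, 1)" by (simp add: of_int_rat quotient_of_Fract)
  ultimately show ?thesis by (simp add: ord2_def)
qed

section \<open>Fourier expansions as Laurent expansions in \<open>q\<close>\<close>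

text \<open>The Fourier expansions of the theorem are unordered sums over all integers, whereas the convergence
theory of Laurent series speaks of sequential sums from the subdegree on. This lemma and the next
one translate between the two.\<close>

lemma fls_has_sum_eval_fls:
  assumes "norm z < fls_conv_radius F" "z \<noteq> 0"
  shows "((\<lambda>n::int. fls_nth F n * z powi n) has_sum eval_fls F z) UNIV"
proof -
  define N where "N = fls_subdegree F"
  define h where "h k = int k + N" for k
  have h: "bij_betw h UNIV {N..}"
    by (rule bij_betw_byWitness[where f' = "\<lambda>n. nat (n - N)"]) (auto simp: h_def)
  have "summable (\<lambda>k. norm (fls_nth F (h k) * z ^ k) * norm (z powi N))"
    using norm_summable_fls'[OF assms(1)] by (intro summable_mult2) (simp add: h_def N_def)
  then have "summable (\<lambda>k. norm (fls_nth F (h k) * z powi h k))"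
    using assms(2) by (simp add: h_def power_int_add norm_mult mult_ac)
  moreover have "(\<lambda>k. fls_nth F (h k) * z powi h k) sums eval_fls F z"
    using sums_eval_fls[of z F] assms by (simp add: h_def N_def)
  ultimately have "((\<lambda>k. fls_nth F (h k) * z powi h k) has_sum eval_fls F z) UNIV"
    by (rule norm_summable_imp_has_sum)
  then have "((\<lambda>n. fls_nth F n * z powi n) has_sum eval_fls F z) {N..}"
    by (subst (asm) has_sum_reindex_bij_betw[OF h, where f = "\<lambda>n. fls_nth F n * z powi n"])
  also have "?this \<longleftrightarrow> ?thesis"
    by (rule has_sum_cong_neutral) (auto simp: N_def)
  finally show ?thesis .
qed

lemma fls_conv_radius_ge_if_summable:
  assumes "(\<lambda>n::int. fls_nth F n * z powi n) summable_on UNIV" "z \<noteq> 0"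
  shows "fls_conv_radius F \<ge> norm z"
proof -
  define N where "N = fls_subdegree F"
  define h where "h k = int k + N" for k
  have h: "bij_betw h UNIV {N..}"
    by (rule bij_betw_byWitness[where f' = "\<lambda>n. nat (n - N)"]) (auto simp: h_def)
  have "(\<lambda>n::int. fls_nth F n * z powi n) summable_on {N..}"
    using assms(1) by (rule summable_on_subset) auto
  then have "(\<lambda>k. fls_nth F (h k) * z powi h k) summable_on UNIV"
    by (subst summable_on_reindex_bij_betw[OF h, where f = "\<lambda>n. fls_nth F n * z powi n"])
  then have "summable (\<lambda>k. fls_nth F (h k) * z powi h k)"
    by (rule summable_on_imp_summable)
  then have "summable (\<lambda>k. fls_nth F (h k) * z powi h k * z powi (- N))"
    by (rule summable_mult2)
  moreover have "fls_nth F (h k) * z powi h k * z powi (- N) = fps_nth (fls_base_factor_to_fps F) k * z ^ k" for k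
    using assms(2) by (simp add: h_def N_def power_int_add power_int_minus field_simps)
  ultimately have "summable (\<lambda>k. fps_nth (fls_base_factor_to_fps F) k * z ^ k)"
    by simp
  then show ?thesis
    unfolding fls_conv_radius_altdef fps_conv_radius_def by (rule conv_radius_geI)
qed

lemma norm_exp_2_pi_i: "norm (exp (2 * of_real pi * \<i> * z)) = exp (- (2 * pi * Im z))"
  by (simp add: norm_exp_eq_Re)

text \<open>Every \<open>q \<noteq> 0\<close> close to 0 is \<open>exp (2 \<pi> \<i> z)\<close> for \<open>z = Ln q / (2 \<pi> \<i>)\<close>, and this \<open>z\<close> has a large imaginary part.
So the uniqueness of Fourier expansions follows from that of Laurent expansions. Although \<open>Ln\<close> is
discontinuous, the function of \<open>q\<close> obtained in this way is the sum of the series near 0 and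
hence holomorphic there, up to the singularity at 0.\<close>

lemma has_fourier_expansion_imp_has_laurent_expansion:
  assumes "has_fourier_expansion f F"
  shows "(\<lambda>q. f (Ln q / (2 * of_real pi * \<i>))) has_laurent_expansion F"
proof -
  obtain y where y: "\<And>z. Im z > y \<Longrightarrow>
      ((\<lambda>n::int. fls_nth F n * exp (2 * of_real pi * \<i> * z) powi n) has_sum f z) UNIV"
    using assms by (auto simp: has_fourier_expansion_def)
  define r where "r = exp (- (2 * pi * y))"
  have sum: "((\<lambda>n::int. fls_nth F n * q powi n) has_sum f (Ln q / (2 * of_real pi * \<i>))) UNIV"
    if "q \<noteq> 0" "norm q < r" for q
  proof -
    define z where "z = Ln q / (2 * of_real pi * \<i>)"
    have q: "exp (2 * of_real pi * \<i> * z) = q"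
      using that by (simp add: z_def)
    then have "exp (- (2 * pi * Im z)) < r"
      using that norm_exp_2_pi_i[of z] by simp
    then have "Im z > y" by (simp add: r_def)
    from y[OF this] show ?thesis by (simp only: q z_def[symmetric])
  qed
  have radius: "fls_conv_radius F \<ge> ereal (r / 2)"
    using fls_conv_radius_ge_if_summable[of F "of_real (r / 2)"] sum[of "of_real (r / 2)"]
    by (auto simp: r_def dest: has_sum_imp_summable)
  have "eventually (\<lambda>q. q \<in> ball 0 (r / 2) - {0}) (at (0 :: complex))"
    by (rule eventually_at_in_open) (auto simp: r_def)
  then have "eventually (\<lambda>q. eval_fls F q = f (Ln q / (2 * of_real pi * \<i>))) (at 0)"
  proof eventually_elim
    case (elim q)
    then have q: "q \<noteq> 0" "norm q < r / 2" by auto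
    have "ereal (norm q) < fls_conv_radius F"
      using q(2) radius by (meson ereal_less_eq(3) less_ereal.simps(1) less_le_trans)
    then have "((\<lambda>n::int. fls_nth F n * q powi n) has_sum eval_fls F q) UNIV"
      using q by (intro fls_has_sum_eval_fls)
    moreover have "norm q < r" using q norm_ge_zero[of q] by linarith
    ultimately show ?case using sum[of q] q by (blast intro: has_sum_unique)
  qed
  moreover have "fls_conv_radius F > 0"
    using radius by (rule less_le_trans[rotated]) (simp add: r_def)
  ultimately show ?thesis by (simp add: has_laurent_expansion_def)
qed

lemma has_laurent_expansion_imp_has_fourier_expansion:
  assumes g: "g has_laurent_expansion F"
    and f: "eventually (\<lambda>q. \<forall>z. exp (2 * of_real pi * \<i> * z) = q \<longrightarrow> f z = g q) (at 0)"
  shows "has_fourier_expansion f F"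
proof -
  have radius: "fls_conv_radius F > 0" and eval: "eventually (\<lambda>q. eval_fls F q = g q) (at 0)"
    using g by (auto simp: has_laurent_expansion_def)
  have "eventually (\<lambda>q. q \<in> eball 0 (fls_conv_radius F) - {0}) (at 0)"
    using radius by (intro eventually_at_in_open) (auto simp: zero_ereal_def)
  with eval f have "eventually (\<lambda>q. \<forall>z. exp (2 * of_real pi * \<i> * z) = q \<longrightarrow>
      ((\<lambda>n::int. fls_nth F n * q powi n) has_sum f z) UNIV) (at 0)"
  proof eventually_elim
    case (elim q)
    then have "((\<lambda>n::int. fls_nth F n * q powi n) has_sum eval_fls F q) UNIV"
      by (intro fls_has_sum_eval_fls) auto
    with elim show ?case by auto
  qed
  then obtain r where r: "r > 0" and "\<And>q. q \<noteq> 0 \<Longrightarrow> norm q < r \<Longrightarrow>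
      \<forall>z. exp (2 * of_real pi * \<i> * z) = q \<longrightarrow> ((\<lambda>n::int. fls_nth F n * q powi n) has_sum f z) UNIV"
    unfolding eventually_at dist_0_norm dist_commute[of _ 0] by blast
  then have sum: "\<And>q z. q \<noteq> 0 \<Longrightarrow> norm q < r \<Longrightarrow> exp (2 * of_real pi * \<i> * z) = q \<Longrightarrow>
      ((\<lambda>n::int. fls_nth F n * q powi n) has_sum f z) UNIV"
    by blast
  define y where "y = max 0 (- ln r / (2 * pi))"
  have "((\<lambda>n::int. fls_nth F n * exp (2 * of_real pi * \<i> * z) powi n) has_sum f z) UNIV"
    if "Im z > y" for z
  proof -
    have "- ln r / (2 * pi) < Im z" using that by (simp add: y_def)
    then have "- (2 * pi * Im z) < ln r" by (simp add: field_simps)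
    then have "exp (- (2 * pi * Im z)) < exp (ln r)" by (simp only: exp_less_cancel_iff)
    then have "norm (exp (2 * of_real pi * \<i> * z)) < r" using r by (simp add: norm_exp_2_pi_i)
    then show ?thesis by (intro sum) auto
  qed
  moreover have "y \<ge> 0" by (simp add: y_def)
  ultimately show ?thesis unfolding has_fourier_expansion_def by blast
qed

lemma fourier_coeff_eq:
  assumes "has_fourier_expansion f F"
  shows "fourier_coeff n f = fls_nth F n"
proof -
  have "(THE F. has_fourier_expansion f F) = F"
    using assms has_laurent_expansion_unique has_fourier_expansion_imp_has_laurent_expansion
    by (intro the_equality) blast+
  then show ?thesis by (simp add: fourier_coeff_def)
qed

section \<open>The expansion of the Eisenstein series\<close>

definition eisenstein_fps :: "complex fps" where
  "eisenstein_fps = Abs_fps (\<lambda>n. of_nat (sigma_star_2_3 n))"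

text \<open>A crude bound: it only has to provide some positive radius of convergence, as Fourier expansions
concern large imaginary parts.\<close>

lemma sigma_star_le: "sigma_star_2_3 n \<le> 16 ^ n"
proof (cases "n = 0")
  case True
  then show ?thesis by (simp add: sigma_star_2_3_def)
next
  case False
  have sub: "{d. 0 < d \<and> d dvd n \<and> \<not> 2 dvd (n div d)} \<subseteq> {0<..n}"
    using False by (auto dest: dvd_imp_le)
  have "sigma_star_2_3 n \<le> (\<Sum>d\<in>{0<..n}. d ^ 3)"
    unfolding sigma_star_2_3_def using sub by (intro sum_mono2) auto
  also have "\<dots> \<le> of_nat (card {0<..n}) * n ^ 3"
    by (rule sum_bounded_above) (simp add: power_mono)
  also have "\<dots> = n ^ 4" by (simp add: eval_nat_numeral)
  also have "\<dots> \<le> (2 ^ n) ^ 4"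
    using less_exp[of n] by (intro power_mono) auto
  also have "\<dots> = (2 ^ 4) ^ n" by (simp only: mult.commute flip: power_mult)
  also have "\<dots> = (16 :: nat) ^ n" by simp
  finally show ?thesis .
qed

lemma fps_conv_radius_eisenstein_fps: "fps_conv_radius eisenstein_fps > 0"
proof -
  have "summable (\<lambda>n. fps_nth eisenstein_fps n * (1 / 32) ^ n)"
  proof (rule summable_comparison_test')
    show "summable (\<lambda>n. (1 / 2 :: real) ^ n)" by (simp add: summable_geometric)
    fix n :: nat
    have "norm (fps_nth eisenstein_fps n * (1 / 32) ^ n) = real (sigma_star_2_3 n) * (1 / 32) ^ n"
      by (simp add: eisenstein_fps_def norm_mult norm_power norm_divide)
    also have "\<dots> \<le> 16 ^ n * (1 / 32) ^ n"
    proof (rule mult_right_mono)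
      have "real (sigma_star_2_3 n) \<le> real (16 ^ n)"
        using sigma_star_le[of n] by (simp only: of_nat_le_iff)
      then show "real (sigma_star_2_3 n) \<le> 16 ^ n" by simp
    qed simp
    also have "\<dots> = (1 / 2) ^ n" by (simp flip: power_mult_distrib)
    finally show "norm (fps_nth eisenstein_fps n * (1 / 32) ^ n) \<le> (1 / 2) ^ n" .
  qed
  then have "fps_conv_radius eisenstein_fps \<ge> norm (1 / 32 :: complex)"
    unfolding fps_conv_radius_def by (rule conv_radius_geI)
  then show ?thesis by (rule less_le_trans[rotated]) simp
qed

lemma E_inf_4_eq_eval_fps:
  assumes "norm (exp (2 * of_real pi * \<i> * z)) < fps_conv_radius eisenstein_fps"
  shows "E_inf_4 z = eval_fps eisenstein_fps (exp (2 * of_real pi * \<i> * z))"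
proof -
  define q where "q = exp (2 * of_real pi * \<i> * z)"
  have q: "norm q < fps_conv_radius eisenstein_fps" using assms by (simp only: q_def)
  have "((\<lambda>n. fps_nth eisenstein_fps n * q ^ n) has_sum eval_fps eisenstein_fps q) UNIV"
    using q by (intro norm_summable_imp_has_sum norm_summable_fps sums_eval_fps)
  also have "?this \<longleftrightarrow> ((\<lambda>n. of_nat (sigma_star_2_3 n) * q ^ n) has_sum eval_fps eisenstein_fps q) {1..}"
    by (rule has_sum_cong_neutral) (auto simp: eisenstein_fps_def not_le sigma_star_2_3_def)
  finally show ?thesis
    unfolding E_inf_4_def q_def[symmetric] by (rule infsumI)
qed

lemma fourier_coeff_E_inf_4_powi:
  "fourier_coeff n (\<lambda>z. E_inf_4 z powi k) = fls_nth (fps_to_fls eisenstein_fps powi k) n"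
proof (rule fourier_coeff_eq, rule has_laurent_expansion_imp_has_fourier_expansion)
  have "eval_fps eisenstein_fps has_fps_expansion eisenstein_fps"
    using fps_conv_radius_eisenstein_fps by (rule eval_fps_has_fps_expansion)
  then show "(\<lambda>q. eval_fps eisenstein_fps q powi k) has_laurent_expansion fps_to_fls eisenstein_fps powi k"
    by (intro has_laurent_expansion_power_int has_laurent_expansion_fps)
  have "eventually (\<lambda>q. q \<in> eball 0 (fps_conv_radius eisenstein_fps) - {0}) (at 0)"
    using fps_conv_radius_eisenstein_fps by (intro eventually_at_in_open) (auto simp: zero_ereal_def)
  then show "eventually (\<lambda>q. \<forall>z. exp (2 * of_real pi * \<i> * z) = q \<longrightarrow>
      E_inf_4 z powi k = eval_fps eisenstein_fps q powi k) (at 0)"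
    by eventually_elim (auto simp: E_inf_4_eq_eval_fps)
qed

section \<open>The constant term\<close>

definition of_int_fps :: "int fps \<Rightarrow> 'a::comm_ring_1 fps" where
  "of_int_fps f = Abs_fps (\<lambda>n. of_int (fps_nth f n))"

lemma of_int_fps_nth: "fps_nth (of_int_fps f) n = of_int (fps_nth f n)"
  by (simp add: of_int_fps_def)

lemma of_int_fps_1: "of_int_fps 1 = 1"
  by (rule fps_ext) (simp add: of_int_fps_def)

lemma of_int_fps_mult: "of_int_fps (f * g) = of_int_fps f * of_int_fps g"
  by (rule fps_ext) (simp add: of_int_fps_def fps_mult_nth)

lemma of_int_fps_power: "of_int_fps (f ^ n) = of_int_fps f ^ n"
  by (induction n) (simp_all add: of_int_fps_1 of_int_fps_mult)

lemma eisenstein_fps_eq: "eisenstein_fps = fps_X * of_int_fps shifted_eisenstein_fps"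
proof (rule fps_ext)
  fix n show "fps_nth eisenstein_fps n = fps_nth (fps_X * of_int_fps shifted_eisenstein_fps) n"
    by (cases n) (simp_all add: eisenstein_fps_def of_int_fps_def shifted_eisenstein_fps_def sigma_star_0)
qed

text \<open>\<open>E = q F\<close>, so the constant term of \<open>E^(-s)\<close> is the coefficient of \<open>q^s\<close> in \<open>F^(-s)\<close>, which is computed
with integer series.\<close>

lemma eisenstein_inverse_power_coeff:
  assumes "shifted_eisenstein_fps * G = 1"
  shows "fls_nth (fps_to_fls eisenstein_fps powi (- int s)) 0 = of_int (fps_nth (G ^ s) s)"
proof -
  define u :: "complex fls" where "u = fps_to_fls (of_int_fps G ^ s)"
  define w :: "complex fls" where "w = fps_to_fls (of_int_fps shifted_eisenstein_fps ^ s)"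
  have "of_int_fps shifted_eisenstein_fps * of_int_fps G = (1 :: complex fps)"
    by (simp add: assms of_int_fps_1 flip: of_int_fps_mult)
  then have wu: "w * u = 1"
    by (simp add: u_def w_def flip: fls_times_fps_to_fls power_mult_distrib)
  have "fps_to_fls eisenstein_fps ^ s = fls_X ^ s * w"
    by (simp add: eisenstein_fps_eq w_def fls_times_fps_to_fls power_mult_distrib fps_to_fls_power)
  also have "\<dots> = fls_shift (- int s) w"
    by (simp add: fls_X_power_conv_shift_1 fls_X_intpow_times_conv_shift)
  finally have "fps_to_fls eisenstein_fps ^ s * fls_shift (int s) u = 1"
    using wu by (simp add: fls_shifted_times_simps)
  then have "inverse (fps_to_fls eisenstein_fps ^ s) = fls_shift (int s) u"
    by (rule inverse_unique)
  then have "fps_to_fls eisenstein_fps powi (- int s) = fls_shift (int s) u"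
    by (simp add: power_int_minus)
  then show ?thesis
    by (simp add: u_def of_int_fps_nth flip: of_int_fps_power)
qed

theorem theorem4p1:
  fixes x s :: nat
  assumes "s = 2 ^ x"
  shows "\<exists>r::rat. fourier_coeff 0 (\<lambda>z. E_inf_4 z powi (- int s)) = of_rat r \<and> ord2 r = 3"
proof -
  define G where "G = fps_right_inverse shifted_eisenstein_fps 1"
  have FG: "shifted_eisenstein_fps * G = 1"
    unfolding G_def by (rule fps_right_inverse) (simp add: shifted_eisenstein_fps_nth_0)
  define m where "m = fps_nth (G ^ s) s"
  have "fourier_coeff 0 (\<lambda>z. E_inf_4 z powi (- int s)) = of_rat (of_int m)"
    by (simp add: fourier_coeff_E_inf_4_powi eisenstein_inverse_power_coeff[OF FG] m_def)
  moreover have "ord2 (of_int m) = 3"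
    using shifted_eisenstein_inverse_power_coeff[OF FG, of x] by (simp add: ord2_of_int_eq_3 m_def assms)
  ultimately show ?thesis by blast
qed

end
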